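(* Let $\omega$ be a non-quasianalytic weight function. Then the space of multipliers of $\mathcal{O}_{M,\omega}(\mathbb{R}^N)$ is $\mathcal{O}_{M,\omega}(\mathbb{R}^N)$ itself: $M(\mathcal{O}_{M,\omega}(\mathbb{R}^N))=\mathcal{O}_{M,\omega}(\mathbb{R}^N)$.
   Context: Weights. A non-quasianalytic weight function is a continuous increasing function $\omega:[0,\infty)\to[0,\infty)$ such that: ($\alpha$) there is $K\ge 1$ with $\omega(2t)\le K(1+\omega(t))$ for all $t\ge 0$; ($\beta$) $\int_1^\infty \frac{\omega(t)}{1+t^2}\,dt<\infty$; ($\gamma$) there are $a\in\mathbb{R}$, $b>0$ with $\omega(t)\ge a+b\log(1+t)$ for all $t\ge 0$; ($\delta$) $\varphi_\omega(t)=\omega(e^t)$ is convex. It is assumed (normalization) that $\omega$ vanishes on $[0,1]$. For $x\in\mathbb{R}^N$, $\omega(x):=\omega(|x|)$. The Young conjugate is $\varphi^*_\omega(s):=\sup_{t\ge 0}\{st-\varphi_\omega(t)\}$, $s\ge 0$ (the value $+\infty$ is allowed, with $\exp(-\infty)=0$). Spaces. $\mathcal{E}_\omega(\mathbb{R}^N)$ is the space of $\omega$-ultradifferentiable functions: all $f\in C^\infty(\mathbb{R}^N)$ with $p_{K,m}(f):=\sup_{x\in K}\sup_{\alpha\in\mathbb{N}_0^N}|\partial^\alpha f(x)|\exp\left(-m\varphi^*_\omega\left(\frac{|\alpha|}{m}\right)\right)<\infty$ for all compact $K\subset\mathbb{R}^N$ and $m\in\mathbb{N}$, topologized by the seminorms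 $p_{K,m}$. For $m,n\in\mathbb{N}$ let $\mathcal{O}^m_{n,\omega}(\mathbb{R}^N)$ be the space of all $f\in C^\infty(\mathbb{R}^N)$ with $r_{m,n}(f):=\sup_{\alpha\in\mathbb{N}_0^N}\sup_{x\in\mathbb{R}^N}|\partial^\alpha f(x)|\exp\left(-n\omega(x)-m\varphi^*_\omega\left(\frac{|\alpha|}{m}\right)\right)<\infty$, with norm $r_{m,n}$. Set $\mathcal{O}_{M,\omega}(\mathbb{R}^N):=\bigcap_{m}\bigcup_{n}\mathcal{O}^m_{n,\omega}(\mathbb{R}^N)$ with the topology of the projective limit over $m$ of the locally convex inductive limits $\mathrm{ind}_{n}\,\mathcal{O}^m_{n,\omega}(\mathbb{R}^N)$. It is continuously included in $\mathcal{E}_\omega(\mathbb{R}^N)$ with dense range. Multipliers. For a locally convex Hausdorff space $E$ of $\omega$-ultradifferentiable functions on $\mathbb{R}^N$ continuously included in $\mathcal{E}_\omega(\mathbb{R}^N)$ with dense range, $M(E)$ is the largest space of $\omega$-ultradifferentiable functions on $\mathbb{R}^N$ such that (1) $fg\in E$ for all $f\in E$, $g\in M(E)$, and (2) for all $f\in M(E)$ the operator $M_f:E\to E$, $g\mapsto fg$, is continuous. Thus $M(E)$ consists of all $f\in\mathcal{E}_\omega(\mathbb{R}^N)$ such that $fg\in E$ for all $g\in E$ and $g\mapsto fg$ is continuous on $E$. *)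

theory Defs
  imports "HOL-Analysis.Analysis"
begin

section \<open>Weight functions\<close>

text \<open>A weight function on \<open>[0,\<infinity>)\<close> is represented by a function on the reals of which only the
  values on \<open>{0..}\<close> matter.\<close>

definition nonquasianalytic_weight :: "(real \<Rightarrow> real) \<Rightarrow> bool" where
  "nonquasianalytic_weight \<omega> \<longleftrightarrow>
     continuous_on {0..} \<omega> \<and> mono_on {0..} \<omega> \<and> (\<forall>t\<ge>0. 0 \<le> \<omega> t) \<and>
     (\<exists>K\<ge>1. \<forall>t\<ge>0. \<omega> (2 * t) \<le> K * (1 + \<omega> t)) \<and>
     set_integrable lborel {1..} (\<lambda>t. \<omega> t / (1 + t\<^sup>2)) \<and>
     (\<exists>a b. b > 0 \<and> (\<forall>t\<ge>0. \<omega> t \<ge> a + b * ln (1 + t))) \<and>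
     convex_on UNIV (\<lambda>t. \<omega> (exp t)) \<and>
     (\<forall>t\<in>{0..1}. \<omega> t = 0)"

definition young_conj :: "(real \<Rightarrow> real) \<Rightarrow> real \<Rightarrow> ereal" where
  "young_conj \<omega> s = (SUP t\<in>{0..}. ereal (s * t - \<omega> (exp t)))"

definition ereal_exp :: "ereal \<Rightarrow> ennreal" where
  "ereal_exp s = (case s of ereal r \<Rightarrow> ennreal (exp r) | PInfty \<Rightarrow> \<infinity> | MInfty \<Rightarrow> 0)"


section \<open>Smooth functions and partial derivatives\<close>

definition partial_deriv :: "'n \<Rightarrow> (real^'n \<Rightarrow> complex) \<Rightarrow> real^'n \<Rightarrow> complex" where
  "partial_deriv i f x = vector_derivative (\<lambda>t. f (x + t *\<^sub>R axis i 1)) (at 0)"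

definition iter_partial_deriv :: "'n list \<Rightarrow> (real^'n \<Rightarrow> complex) \<Rightarrow> real^'n \<Rightarrow> complex" where
  "iter_partial_deriv js f = foldr partial_deriv js f"

definition smooth :: "(real^'n \<Rightarrow> complex) \<Rightarrow> bool" where
  "smooth f \<longleftrightarrow>
     (\<forall>js. continuous_on UNIV (iter_partial_deriv js f) \<and>
       (\<forall>i x. (\<lambda>t. iter_partial_deriv js f (x + t *\<^sub>R axis i 1)) differentiable (at 0)))"

text \<open>The derivative of order \<open>\<alpha>\<close> takes the \<open>i\<close>-th partial derivative \<open>\<alpha> i\<close> times, in some order; the
  index type carries no canonical order, and for smooth functions the choice is irrelevant by
  Schwarz's theorem.\<close>

definition multi_deriv :: "('n \<Rightarrow> nat) \<Rightarrow> (real^'n \<Rightarrow> complex) \<Rightarrow> real^'n \<Rightarrow> complex" where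
  "multi_deriv \<alpha> f = iter_partial_deriv (SOME js. \<forall>i. count_list js i = \<alpha> i) f"

definition multi_order :: "('n::finite \<Rightarrow> nat) \<Rightarrow> nat" where
  "multi_order \<alpha> = (\<Sum>i\<in>UNIV. \<alpha> i)"


section \<open>Locally convex topologies on spaces of functions\<close>

definition locally_convex_topology :: "('a \<Rightarrow> complex) topology \<Rightarrow> bool" where
  "locally_convex_topology T \<longleftrightarrow>
     (\<lambda>x. 0) \<in> topspace T \<and>
     continuous_map (prod_topology T T) T (\<lambda>(f, g) x. f x + g x) \<and>
     continuous_map (prod_topology euclidean T) T (\<lambda>(c, f) x. c * f x) \<and>
     (\<forall>U. openin T U \<and> (\<lambda>x. 0) \<in> U \<longrightarrow>
       (\<exists>W. openin T W \<and> (\<lambda>x. 0) \<in> W \<and> W \<subseteq> U \<and>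
         (\<forall>f\<in>W. \<forall>g\<in>W. \<forall>u\<in>{0..1::real}.
           (\<lambda>x. of_real (1 - u) * f x + of_real u * g x) \<in> W)))"

definition norm_topology ::
  "('a \<Rightarrow> complex) set \<Rightarrow> (('a \<Rightarrow> complex) \<Rightarrow> ennreal) \<Rightarrow> ('a \<Rightarrow> complex) topology" where
  "norm_topology X r =
     topology_generated_by
       {{g \<in> X. r (\<lambda>x. g x - f x) < ennreal \<epsilon>} | f \<epsilon>. f \<in> X \<and> \<epsilon> > 0}"

text \<open>The finest locally convex topology on the union of the spaces \<open>topspace (T n)\<close>, \<open>n \<in> I\<close>, for
  which all inclusions are continuous. It is the supremum of all such topologies, since suprema of
  locally convex topologies are locally convex.\<close>

definition lc_inductive_limit ::
  "nat set \<Rightarrow> (nat \<Rightarrow> ('a \<Rightarrow> complex) topology) \<Rightarrow> ('a \<Rightarrow> complex) topology" where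
  "lc_inductive_limit I T =
     topology_generated_by
       {U. \<exists>S. locally_convex_topology S \<and> topspace S = (\<Union>n\<in>I. topspace (T n)) \<and>
          (\<forall>n\<in>I. continuous_map (T n) S (\<lambda>f. f)) \<and> openin S U}"

text \<open>The coarsest topology on the intersection of the spaces \<open>topspace (T m)\<close>, \<open>m \<in> I\<close>, for which
  all inclusions are continuous.\<close>

definition projective_limit ::
  "nat set \<Rightarrow> (nat \<Rightarrow> ('a \<Rightarrow> complex) topology) \<Rightarrow> ('a \<Rightarrow> complex) topology" where
  "projective_limit I T =
     topology_generated_by
       {U \<inter> (\<Inter>m\<in>I. topspace (T m)) | U m. m \<in> I \<and> openin (T m) U}"


section \<open>Spaces of ultradifferentiable functions\<close>

definition E_seminorm ::
  "(real \<Rightarrow> real) \<Rightarrow> (real^'n) set \<Rightarrow> nat \<Rightarrow> (real^'n \<Rightarrow> complex) \<Rightarrow> ennreal" where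
  "E_seminorm \<omega> K m f =
     (SUP x\<in>K. SUP \<alpha>. ennreal (norm (multi_deriv \<alpha> f x)) *
        ereal_exp (- (ereal (real m) * young_conj \<omega> (real (multi_order \<alpha>) / real m))))"

definition E_space :: "(real \<Rightarrow> real) \<Rightarrow> (real^'n \<Rightarrow> complex) set" where
  "E_space \<omega> = {f. smooth f \<and> (\<forall>K. \<forall>m\<ge>1. compact K \<longrightarrow> E_seminorm \<omega> K m f < \<infinity>)}"

definition O_norm ::
  "(real \<Rightarrow> real) \<Rightarrow> nat \<Rightarrow> nat \<Rightarrow> (real^'n \<Rightarrow> complex) \<Rightarrow> ennreal" where
  "O_norm \<omega> m n f =
     (SUP \<alpha>. SUP x. ennreal (norm (multi_deriv \<alpha> f x)) *
        ereal_exp (- ereal (real n * \<omega> (norm x)) -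
          ereal (real m) * young_conj \<omega> (real (multi_order \<alpha>) / real m)))"

definition O_step :: "(real \<Rightarrow> real) \<Rightarrow> nat \<Rightarrow> nat \<Rightarrow> (real^'n \<Rightarrow> complex) set" where
  "O_step \<omega> m n = {f. smooth f \<and> O_norm \<omega> m n f < \<infinity>}"

definition OM_space :: "(real \<Rightarrow> real) \<Rightarrow> (real^'n \<Rightarrow> complex) set" where
  "OM_space \<omega> = (\<Inter>m\<in>{1..}. \<Union>n\<in>{1..}. O_step \<omega> m n)"

definition OM_topology :: "(real \<Rightarrow> real) \<Rightarrow> (real^'n \<Rightarrow> complex) topology" where
  "OM_topology \<omega> =
     projective_limit {1..} (\<lambda>m.
       lc_inductive_limit {1..} (\<lambda>n. norm_topology (O_step \<omega> m n) (O_norm \<omega> m n)))"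


section \<open>Multipliers\<close>

definition multipliers ::
  "(real \<Rightarrow> real) \<Rightarrow> (real^'n \<Rightarrow> complex) topology \<Rightarrow> (real^'n \<Rightarrow> complex) set" where
  "multipliers \<omega> T =
     {f \<in> E_space \<omega>. (\<forall>g\<in>topspace T. (\<lambda>x. f x * g x) \<in> topspace T) \<and>
        continuous_map T T (\<lambda>g x. f x * g x)}"

lemma multipliers_greatest:
  "M \<subseteq> multipliers \<omega> T \<longleftrightarrow>
     M \<subseteq> E_space \<omega> \<and>
     (\<forall>f\<in>M. \<forall>g\<in>topspace T. (\<lambda>x. f x * g x) \<in> topspace T) \<and>
     (\<forall>f\<in>M. continuous_map T T (\<lambda>g x. f x * g x))"
  unfolding multipliers_def by blast

end

theory Submission
  imports Defs
begin

text \<open>Since the constant 1 lies in \<open>O\<^sub>M\<close>, every multiplier lies in \<open>O\<^sub>M\<close>. Conversely, the Leibniz rule, the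
  superadditivity of \<open>k \<mapsto> m \<phi>\<^sup>*(k/m)\<close> and condition (\<open>\<alpha>\<close>), which absorbs the \<open>2\<^sup>k\<close> Leibniz terms,
  bound the norm \<open>r\<close> of a product with indices \<open>m\<close>, \<open>n + n'\<close> by \<open>e\<^sup>M\<close> times the product of the norms of
  the factors with indices \<open>M\<close>, \<open>n\<close> and \<open>M\<close>, \<open>n'\<close>, as soon as \<open>M \<ge> K m\<close>. So multiplication by an
  element of \<open>O\<^sub>M\<close> is continuous between the normed steps. Continuity passes to the inductive limits,
  because a linear map pulls locally convex topologies back to locally convex topologies, and then to
  the projective limit.\<close>

section \<open>Smooth functions\<close>

lemma iter_partial_deriv_Nil [simp]: "iter_partial_deriv [] f = f"
  and iter_partial_deriv_Cons: "iter_partial_deriv (j # js) f = partial_deriv j (iter_partial_deriv js f)"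
  and iter_partial_deriv_snoc: "iter_partial_deriv (js @ [j]) f = iter_partial_deriv js (partial_deriv j f)"
  by (simp_all add: iter_partial_deriv_def)

lemma smooth_partial_deriv: "smooth f \<Longrightarrow> smooth (partial_deriv i f)"
  unfolding smooth_def by (metis iter_partial_deriv_snoc)

lemma smooth_iter_partial_deriv: "smooth f \<Longrightarrow> smooth (iter_partial_deriv js f)"
  by (induction js) (auto simp: iter_partial_deriv_Cons intro: smooth_partial_deriv)

lemma smooth_imp_continuous_on: "smooth f \<Longrightarrow> continuous_on UNIV f"
  unfolding smooth_def by (metis iter_partial_deriv_Nil)

text \<open>\<open>smooth\<close> asserts differentiability only at parameter 0, but at every base
  point. Moving the base point along the axis gives the derivative at every parameter
  \<open>s\<close>, as the fundamental theorem of calculus requires.\<close>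

lemma smooth_has_partial_deriv:
  assumes "smooth f"
  shows "((\<lambda>t. f (x + t *\<^sub>R axis i 1)) has_vector_derivative
           partial_deriv i f (x + s *\<^sub>R axis i 1)) (at s)"
proof -
  have "(\<lambda>t. f ((x + s *\<^sub>R axis i 1) + t *\<^sub>R axis i 1)) differentiable (at 0)"
    using assms unfolding smooth_def by (metis iter_partial_deriv_Nil)
  \<comment> \<open>Writing 0 as \<open>s - s\<close> puts the fact in the form the chain rule needs
    for the shift \<open>t - s\<close>.\<close>
  then have "((\<lambda>t. f ((x + s *\<^sub>R axis i 1) + t *\<^sub>R axis i 1)) has_vector_derivative
           partial_deriv i f (x + s *\<^sub>R axis i 1)) (at (s - s))"
    by (simp add: partial_deriv_def vector_derivative_works)
  then have "((\<lambda>t. f ((x + s *\<^sub>R axis i 1) + t *\<^sub>R axis i 1)) \<circ> (\<lambda>t. t - s) has_vector_derivative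
           1 *\<^sub>R partial_deriv i f (x + s *\<^sub>R axis i 1)) (at s)"
    by (intro vector_diff_chain_at) (auto intro!: derivative_eq_intros)
  moreover have "(\<lambda>t. f ((x + s *\<^sub>R axis i 1) + t *\<^sub>R axis i 1)) \<circ> (\<lambda>t. t - s)
      = (\<lambda>t. f (x + t *\<^sub>R axis i 1))"
    by (auto simp: fun_eq_iff algebra_simps)
  ultimately show ?thesis by simp
qed

lemma smooth_has_partial_deriv_0:
  assumes "smooth f"
  shows "((\<lambda>t. f (x + t *\<^sub>R axis i 1)) has_vector_derivative partial_deriv i f x) (at 0)"
  using smooth_has_partial_deriv[OF assms, of x i 0] by simp

lemma partial_deriv_eqI:
  "(\<And>x. ((\<lambda>t. f (x + t *\<^sub>R axis i 1)) has_vector_derivative f' x) (at 0)) \<Longrightarrow> partial_deriv i f = f'"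
  by (auto simp: fun_eq_iff partial_deriv_def intro: vector_derivative_at)

text \<open>The smooth functions are the largest class closed under partial differentiation whose members
  are continuous and partially differentiable; the algebra generated by them is again such a class.\<close>

lemma smooth_coinduct:
  assumes "f \<in> S"
    and "\<And>f. f \<in> S \<Longrightarrow> continuous_on UNIV f"
    and "\<And>f i x. f \<in> S \<Longrightarrow> (\<lambda>t. f (x + t *\<^sub>R axis i 1)) differentiable (at 0)"
    and "\<And>f i. f \<in> S \<Longrightarrow> partial_deriv i f \<in> S"
  shows "smooth f"
proof -
  have "iter_partial_deriv js f \<in> S" for js
    by (induction js) (auto simp: iter_partial_deriv_Cons assms)
  then show ?thesis
    unfolding smooth_def using assms by blast
qed

inductive_set smooth_algebra :: "(real^'n \<Rightarrow> complex) set" where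
  base: "smooth f \<Longrightarrow> f \<in> smooth_algebra"
| add: "f \<in> smooth_algebra \<Longrightarrow> g \<in> smooth_algebra \<Longrightarrow> (\<lambda>x. f x + g x) \<in> smooth_algebra"
| mult: "f \<in> smooth_algebra \<Longrightarrow> g \<in> smooth_algebra \<Longrightarrow> (\<lambda>x. f x * g x) \<in> smooth_algebra"

text \<open>The derivative is only claimed to be some member of the algebra. This lets the sum and
  product rules feed the induction directly; \<open>partial_deriv_eqI\<close> identifies that member
  with \<open>partial_deriv i f\<close> afterwards.\<close>

lemma smooth_algebra_closed:
  assumes "f \<in> smooth_algebra"
  shows "continuous_on UNIV f \<and>
    (\<forall>i. \<exists>f'\<in>smooth_algebra. \<forall>x. ((\<lambda>t. f (x + t *\<^sub>R axis i 1)) has_vector_derivative f' x) (at 0))"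
  using assms
proof induction
  case (base f)
  then show ?case
    by (blast intro: smooth_algebra.base smooth_has_partial_deriv_0 smooth_imp_continuous_on
        smooth_partial_deriv)
next
  case (add f g)
  have "\<exists>h\<in>smooth_algebra. \<forall>x. ((\<lambda>t. f (x + t *\<^sub>R axis i 1) + g (x + t *\<^sub>R axis i 1))
      has_vector_derivative h x) (at 0)" for i
  proof -
    obtain f' g' where "f' \<in> smooth_algebra" "g' \<in> smooth_algebra"
      "\<And>x. ((\<lambda>t. f (x + t *\<^sub>R axis i 1)) has_vector_derivative f' x) (at 0)"
      "\<And>x. ((\<lambda>t. g (x + t *\<^sub>R axis i 1)) has_vector_derivative g' x) (at 0)"
      using add.IH by metis
    then show ?thesis
      by (intro bexI[of _ "\<lambda>x. f' x + g' x"])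
        (auto intro: smooth_algebra.add has_vector_derivative_add)
  qed
  then show ?case
    using add.IH by (auto intro: continuous_intros)
next
  case (mult f g)
  have "\<exists>h\<in>smooth_algebra. \<forall>x. ((\<lambda>t. f (x + t *\<^sub>R axis i 1) * g (x + t *\<^sub>R axis i 1))
      has_vector_derivative h x) (at 0)" for i
  proof -
    obtain f' g' where *: "f' \<in> smooth_algebra" "g' \<in> smooth_algebra"
      "\<And>x. ((\<lambda>t. f (x + t *\<^sub>R axis i 1)) has_vector_derivative f' x) (at 0)"
      "\<And>x. ((\<lambda>t. g (x + t *\<^sub>R axis i 1)) has_vector_derivative g' x) (at 0)"
      using mult.IH by metis
    show ?thesis
    proof (intro bexI[of _ "\<lambda>x. f x * g' x + f' x * g x"] allI)
      show "((\<lambda>t. f (x + t *\<^sub>R axis i 1) * g (x + t *\<^sub>R axis i 1))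
        has_vector_derivative f x * g' x + f' x * g x) (at 0)" for x
        using has_vector_derivative_mult[OF *(3)[of x] *(4)[of x]] by simp
    qed (use * mult.hyps in \<open>auto intro!: smooth_algebra.add smooth_algebra.mult\<close>)
  qed
  then show ?case
    using mult.IH by (auto intro: continuous_intros)
qed

lemma smooth_algebra_smooth:
  assumes "f \<in> smooth_algebra"
  shows "smooth f"
proof (rule smooth_coinduct[OF assms])
  fix f :: "real^'n \<Rightarrow> complex" and i x
  assume f: "f \<in> smooth_algebra"
  then obtain f' where f': "f' \<in> smooth_algebra"
    "\<And>x. ((\<lambda>t. f (x + t *\<^sub>R axis i 1)) has_vector_derivative f' x) (at 0)"
    using smooth_algebra_closed[OF f] by blast
  show "(\<lambda>t. f (x + t *\<^sub>R axis i 1)) differentiable (at 0)"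
    using f'(2) by (rule differentiableI_vector)
  show "partial_deriv i f \<in> smooth_algebra"
    using f' partial_deriv_eqI by metis
qed (simp add: smooth_algebra_closed)

lemma smooth_add: "smooth f \<Longrightarrow> smooth g \<Longrightarrow> smooth (\<lambda>x. f x + g x)"
  and smooth_mult: "smooth f \<Longrightarrow> smooth g \<Longrightarrow> smooth (\<lambda>x. f x * g x)"
  by (auto intro: smooth_algebra_smooth smooth_algebra.intros)

lemma partial_deriv_const: "partial_deriv i (\<lambda>x. c) = (\<lambda>x. 0)"
  by (rule partial_deriv_eqI) simp

lemma iter_partial_deriv_const: "iter_partial_deriv js (\<lambda>x. c) = (\<lambda>x. if js = [] then c else 0)"
  by (induction js) (auto simp: iter_partial_deriv_Cons partial_deriv_const)

lemma smooth_const: "smooth (\<lambda>x. c)"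
  by (simp add: smooth_def iter_partial_deriv_const)

lemma partial_deriv_add:
  "smooth f \<Longrightarrow> smooth g \<Longrightarrow>
    partial_deriv i (\<lambda>x. f x + g x) = (\<lambda>x. partial_deriv i f x + partial_deriv i g x)"
  by (intro partial_deriv_eqI has_vector_derivative_add smooth_has_partial_deriv_0)

lemma partial_deriv_mult:
  assumes "smooth f" "smooth g"
  shows "partial_deriv i (\<lambda>x. f x * g x) = (\<lambda>x. f x * partial_deriv i g x + partial_deriv i f x * g x)"
  using has_vector_derivative_mult[OF smooth_has_partial_deriv_0[OF assms(1), of _ i]
      smooth_has_partial_deriv_0[OF assms(2), of _ i]]
  by (intro partial_deriv_eqI) simp

lemma iter_partial_deriv_add:
  "smooth f \<Longrightarrow> smooth g \<Longrightarrow>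
    iter_partial_deriv js (\<lambda>x. f x + g x) = (\<lambda>x. iter_partial_deriv js f x + iter_partial_deriv js g x)"
  by (induction js)
    (auto simp: iter_partial_deriv_Cons partial_deriv_add smooth_iter_partial_deriv)

lemma iter_partial_deriv_cmult:
  assumes "smooth f"
  shows "iter_partial_deriv js (\<lambda>x. c * f x) = (\<lambda>x. c * iter_partial_deriv js f x)"
  using assms
  by (induction js)
    (auto simp: iter_partial_deriv_Cons partial_deriv_mult smooth_const partial_deriv_const
      smooth_iter_partial_deriv)

text \<open>Schwarz's theorem, by differentiating
  \<open>f (x + s e\<^sub>i + t e\<^sub>j) - f (x + s e\<^sub>i) = \<integral>\<^sub>0\<^sup>t \<partial>\<^sub>j f (x + s e\<^sub>i + r e\<^sub>j) dr\<close> under the integral with respect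
  to \<open>s\<close> and then with respect to \<open>t\<close>.\<close>

lemma partial_deriv_commute:
  fixes f :: "real^'n \<Rightarrow> complex"
  assumes f: "smooth f"
  shows "partial_deriv i (partial_deriv j f) = partial_deriv j (partial_deriv i f)"
proof
  fix x
  define a b where "a = (axis i 1 :: real^'n)" and "b = (axis j 1 :: real^'n)"
  have fj: "smooth (partial_deriv j f)" and fi: "smooth (partial_deriv i f)"
    and fij: "smooth (partial_deriv i (partial_deriv j f))"
    using f by (auto intro: smooth_partial_deriv)
  note cont = continuous_on_compose2[OF smooth_imp_continuous_on[OF fj]]
    continuous_on_compose2[OF smooth_imp_continuous_on[OF fij]]
  have int: "integral {0..t} (\<lambda>r. partial_deriv j f (x + s *\<^sub>R a + r *\<^sub>R b))
      = f (x + s *\<^sub>R a + t *\<^sub>R b) - f (x + s *\<^sub>R a)" if "t \<ge> 0" for s t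
  proof -
    have "((\<lambda>r. partial_deriv j f (x + s *\<^sub>R a + r *\<^sub>R b)) has_integral
      (f (x + s *\<^sub>R a + t *\<^sub>R b) - f (x + s *\<^sub>R a + 0 *\<^sub>R b))) {0..t}"
      using that smooth_has_partial_deriv[OF f] unfolding b_def
      by (intro fundamental_theorem_of_calculus) (auto intro: has_vector_derivative_at_within)
    then show ?thesis by (simp add: integral_unique)
  qed
  \<comment> \<open>Both sides are the derivative at \<open>s = 0\<close> of
    \<open>f (x + s a + t b) - f (x + s a)\<close>: the left one directly, the right one by
    rewriting the difference with \<open>int\<close> and differentiating under the integral
    sign.\<close>
  have eq: "partial_deriv i f (x + t *\<^sub>R b) - partial_deriv i f x
      = integral {0..t} (\<lambda>r. partial_deriv i (partial_deriv j f) (x + r *\<^sub>R b))" if t: "t \<ge> 0" for t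
  proof (rule vector_derivative_unique_at)
    show "((\<lambda>s. f (x + s *\<^sub>R a + t *\<^sub>R b) - f (x + s *\<^sub>R a)) has_vector_derivative
        partial_deriv i f (x + t *\<^sub>R b) - partial_deriv i f x) (at 0)"
      using smooth_has_partial_deriv_0[OF f, of "x + t *\<^sub>R b" i]
        smooth_has_partial_deriv_0[OF f, of x i]
      by (intro has_vector_derivative_diff) (auto simp: a_def algebra_simps)
    have "((\<lambda>s. integral (cbox 0 t) (\<lambda>r. partial_deriv j f (x + s *\<^sub>R a + r *\<^sub>R b)))
        has_vector_derivative
        integral (cbox 0 t) (\<lambda>r. partial_deriv i (partial_deriv j f) (x + 0 *\<^sub>R a + r *\<^sub>R b)))
        (at 0 within UNIV)"
    proof (rule leibniz_rule_vector_derivative)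
      show "((\<lambda>s. partial_deriv j f (x + s *\<^sub>R a + r *\<^sub>R b)) has_vector_derivative
        partial_deriv i (partial_deriv j f) (x + s *\<^sub>R a + r *\<^sub>R b)) (at s within UNIV)" for s r
        using smooth_has_partial_deriv[OF fj, of "x + r *\<^sub>R b" i s]
        by (simp add: a_def algebra_simps)
      show "(\<lambda>r. partial_deriv j f (x + s *\<^sub>R a + r *\<^sub>R b)) integrable_on cbox 0 t" for s
        by (intro integrable_continuous cont(1) continuous_intros) auto
      show "continuous_on (UNIV \<times> cbox 0 t)
          (\<lambda>(s, r). partial_deriv i (partial_deriv j f) (x + s *\<^sub>R a + r *\<^sub>R b))"
        unfolding split_beta by (intro cont(2) continuous_intros) auto
    qed auto
    then show "((\<lambda>s. f (x + s *\<^sub>R a + t *\<^sub>R b) - f (x + s *\<^sub>R a)) has_vector_derivative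
        integral {0..t} (\<lambda>r. partial_deriv i (partial_deriv j f) (x + r *\<^sub>R b))) (at 0)"
      using t by (simp add: int)
  qed
  \<comment> \<open>Since \<open>eq\<close> holds for t \<ge> 0 only, the derivative in
    \<open>t\<close> at 0 is one-sided, within \<open>{0..1}\<close>. One-sided derivatives on an
    interval are still unique, which settles the comparison.\<close>
  have "((\<lambda>t. partial_deriv i f (x + t *\<^sub>R b) - partial_deriv i f x) has_vector_derivative
      partial_deriv i (partial_deriv j f) (x + 0 *\<^sub>R b)) (at 0 within {0..1})"
  proof (rule has_vector_derivative_transform)
    show "((\<lambda>t. integral {0..t} (\<lambda>r. partial_deriv i (partial_deriv j f) (x + r *\<^sub>R b)))
        has_vector_derivative partial_deriv i (partial_deriv j f) (x + 0 *\<^sub>R b)) (at 0 within {0..1})"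
      by (intro integral_has_vector_derivative cont(2) continuous_intros) auto
  qed (auto simp: eq)
  moreover have "((\<lambda>t. partial_deriv i f (x + t *\<^sub>R b) - partial_deriv i f x) has_vector_derivative
      partial_deriv j (partial_deriv i f) x - 0) (at 0 within {0..1})"
    unfolding b_def
    by (intro has_vector_derivative_diff has_vector_derivative_at_within[OF smooth_has_partial_deriv_0]
        fi has_vector_derivative_const)
  ultimately show "partial_deriv i (partial_deriv j f) x = partial_deriv j (partial_deriv i f) x"
    using vector_derivative_unique_within_closed_interval[of 0 1 0] by fastforce
qed

section \<open>Derivatives indexed by lists and by multi-indices\<close>

lemma partial_deriv_iter_commute:
  "smooth f \<Longrightarrow> partial_deriv i (iter_partial_deriv js f) = iter_partial_deriv js (partial_deriv i f)"
proof (induction js)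
  case (Cons j js)
  then show ?case
    using partial_deriv_commute[OF smooth_iter_partial_deriv[OF Cons.prems], of i j js]
    by (simp add: iter_partial_deriv_Cons)
qed simp

lemma iter_partial_deriv_append:
  "iter_partial_deriv (us @ vs) f = iter_partial_deriv us (iter_partial_deriv vs f)"
  by (simp add: iter_partial_deriv_def)

text \<open>The head \<open>u\<close> of the first list occurs in \<open>vs\<close>; commutation
  moves it to the front there, and the remaining lists again have equal counts. This makes the
  arbitrary choice in \<open>multi_deriv\<close> harmless.\<close>

lemma iter_partial_deriv_cong_count:
  assumes "smooth f" "\<And>i. count_list us i = count_list vs i"
  shows "iter_partial_deriv us f = iter_partial_deriv vs f"
  using assms(2)
proof (induction us arbitrary: vs)
  case Nil
  then have "vs = []"
    by (metis count_list.simps(1) count_list_0_iff list.set_intros(1) neq_Nil_conv)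
  then show ?case by simp
next
  case (Cons u us)
  have "count_list vs u \<noteq> 0"
    using Cons.prems[of u] by auto
  then obtain ps qs where vs: "vs = ps @ u # qs"
    by (meson count_notin split_list)
  have "count_list us i = count_list (ps @ qs) i" for i
    using Cons.prems[of i] by (auto simp: vs split: if_splits)
  from Cons.IH[OF this] show ?case
    by (simp add: vs iter_partial_deriv_Cons iter_partial_deriv_append
        partial_deriv_iter_commute smooth_iter_partial_deriv assms(1))
qed

lemma ex_list_count_list: "\<exists>js. \<forall>i::'n::finite. count_list js i = \<alpha> i"
proof -
  have "\<exists>js. \<forall>i. count_list js i = (if i \<in> A then \<alpha> i else 0)" if "finite A" for A :: "'n set"
    using that
  proof induction
    case (insert a A)
    then obtain js where js: "\<forall>i. count_list js i = (if i \<in> A then \<alpha> i else 0)" by blast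
    have "count_list (replicate k a) i = (if i = a then k else 0)" for k i
      by (induction k) auto
    then show ?case
      using js insert.hyps by (intro exI[of _ "replicate (\<alpha> a) a @ js"]) auto
  qed (auto intro: exI[of _ "[]"])
  from this[of UNIV] show ?thesis by simp
qed

text \<open>Suprema over multi-indices thereby become suprema over lists, on which the Leibniz rule
  and linearity are proved by plain list induction. The order is paired with the derivative because
  the weight depends on it.\<close>

lemma range_multi_deriv:
  assumes "smooth (f :: real^'n \<Rightarrow> complex)"
  shows "(\<lambda>\<alpha>. (multi_order \<alpha>, multi_deriv \<alpha> f)) ` UNIV
    = (\<lambda>js. (length js, iter_partial_deriv js f)) ` UNIV"
proof -
  have eq: "(multi_order (count_list js), multi_deriv (count_list js) f)
      = (length js, iter_partial_deriv js f)" for js :: "'n list"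
  proof -
    have "\<forall>i. count_list (SOME us. \<forall>i. count_list us i = count_list js i) i = count_list js i"
      by (rule someI_ex) auto
    then show ?thesis
      by (auto simp: multi_order_def multi_deriv_def sum_count_set
          intro: iter_partial_deriv_cong_count[OF assms])
  qed
  have "range count_list = (UNIV :: ('n \<Rightarrow> nat) set)"
    unfolding surj_def fun_eq_iff using ex_list_count_list by metis
  then show ?thesis
    by (metis (no_types, lifting) eq image_cong image_image)
qed


section \<open>The weights and the Leibniz estimate\<close>

definition scaled_conj :: "(real \<Rightarrow> real) \<Rightarrow> nat \<Rightarrow> nat \<Rightarrow> ereal" where
  "scaled_conj \<omega> m k = ereal (real m) * young_conj \<omega> (real k / real m)"

text \<open>A real-valued form of exp(-\<open>scaled_conj\<close>), so that estimates can be carried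
  out in the reals. The case distinction encodes exp(-\<infinity>) = 0, since
  \<open>real_of_ereal\<close> sends \<infinity> to 0 and would give the value 1.\<close>

definition order_weight :: "(real \<Rightarrow> real) \<Rightarrow> nat \<Rightarrow> nat \<Rightarrow> real" where
  "order_weight \<omega> m k = (if scaled_conj \<omega> m k = \<infinity> then 0 else exp (- real_of_ereal (scaled_conj \<omega> m k)))"

lemma order_weight_nonneg: "0 \<le> order_weight \<omega> m k"
  by (simp add: order_weight_def)

text \<open>Clearing the denominator \<open>m\<close> reduces a bound on the extended-real supremum
  to real inequalities at each point; later estimates go through this form.\<close>

lemma scaled_conj_le_iff:
  assumes "m \<ge> 1"
  shows "scaled_conj \<omega> m k \<le> ereal c \<longleftrightarrow> (\<forall>t\<ge>0. real k * t - real m * \<omega> (exp t) \<le> c)"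
proof -
  have "scaled_conj \<omega> m k \<le> ereal c \<longleftrightarrow> young_conj \<omega> (real k / real m) \<le> ereal c / ereal (real m)"
    using assms by (subst ereal_le_divide_pos) (auto simp: scaled_conj_def)
  also have "\<dots> \<longleftrightarrow> (\<forall>t\<ge>0. real k / real m * t - \<omega> (exp t) \<le> c / real m)"
    using assms by (simp add: young_conj_def SUP_le_iff Ball_def)
  also have "\<dots> \<longleftrightarrow> (\<forall>t\<ge>0. real k * t - real m * \<omega> (exp t) \<le> c)"
    using assms by (simp add: pos_le_divide_eq right_diff_distrib mult.commute[of _ "real m"])
  finally show ?thesis .
qed

text \<open>The point \<open>t = 0\<close> contributes 0 to the supremum because of the
  normalization. In particular the value -\<infinity> never occurs.\<close>

lemma scaled_conj_nonneg:
  assumes "\<omega> 1 = 0"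
  shows "0 \<le> scaled_conj \<omega> m k"
proof -
  have "ereal (real k / real m * 0 - \<omega> (exp 0)) \<le> young_conj \<omega> (real k / real m)"
    unfolding young_conj_def by (rule SUP_upper) simp
  then show ?thesis
    using assms by (simp add: scaled_conj_def flip: zero_ereal_def)
qed

lemma ereal_exp_scaled_conj:
  assumes "\<omega> 1 = 0"
  shows "ereal_exp (- ereal c - scaled_conj \<omega> m k) = ennreal (exp (- c) * order_weight \<omega> m k)"
    and "ereal_exp (- scaled_conj \<omega> m k) = ennreal (order_weight \<omega> m k)"
  using scaled_conj_nonneg[of \<omega> m k] assms
  by (cases "scaled_conj \<omega> m k"; simp add: order_weight_def ereal_exp_def exp_diff exp_minus field_simps)+

text \<open>Superadditivity of \<open>k \<mapsto> m \<phi>\<^sup>*(k/m)\<close> needs no convexity: since \<open>\<phi> \<ge> 0\<close>, both suprema may be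
  evaluated at the larger of the two points.\<close>

lemma order_weight_add_le:
  assumes m: "m \<ge> 1" and nonneg: "\<And>t. t \<ge> 0 \<Longrightarrow> 0 \<le> \<omega> t" and "\<omega> 1 = 0"
  shows "order_weight \<omega> m (j + k) \<le> order_weight \<omega> m j * order_weight \<omega> m k"
proof (cases "scaled_conj \<omega> m (j + k)")
  case (real v)
  define \<psi> where "\<psi> t = real m * \<omega> (exp t)" for t
  have \<psi>: "0 \<le> \<psi> t" for t
    using nonneg by (simp add: \<psi>_def)
  have v: "real (j + k) * t - \<psi> t \<le> v" if "t \<ge> 0" for t
    using scaled_conj_le_iff[OF m, of \<omega> "j + k" v] real that by (auto simp: \<psi>_def)
  have sum: "(real j * t - \<psi> t) + (real k * t' - \<psi> t') \<le> v" if "t \<ge> 0" "t' \<ge> 0" for t t'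
  proof (cases "t \<le> t'")
    case True
    then have "real j * t \<le> real j * t'" by (simp add: mult_left_mono)
    then show ?thesis using v[OF that(2)] \<psi>[of t] by (simp add: algebra_simps)
  next
    case False
    then have "real k * t' \<le> real k * t" by (simp add: mult_left_mono)
    then show ?thesis using v[OF that(1)] \<psi>[of t'] by (simp add: algebra_simps)
  qed
  \<comment> \<open>The two suprema are taken one after the other: first over the point belonging to
    \<open>j\<close> with \<open>t\<close> fixed, then over \<open>t\<close>. The first step also
    shows that the conjugate at \<open>j\<close> is finite, so the subtraction in the second is one
    of reals.\<close>
  have j: "scaled_conj \<omega> m j \<le> ereal (v - (real k * t - \<psi> t))" if "t \<ge> 0" for t
    unfolding scaled_conj_le_iff[OF m] using sum[OF _ that] by (fastforce simp: \<psi>_def)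
  obtain vj where vj: "scaled_conj \<omega> m j = ereal vj"
    using j[of 0] scaled_conj_nonneg[of \<omega> m j] assms(3) by (cases "scaled_conj \<omega> m j") auto
  have "real k * t - \<psi> t \<le> v - vj" if "t \<ge> 0" for t
    using j[OF that] vj by simp
  then have k: "scaled_conj \<omega> m k \<le> ereal (v - vj)"
    unfolding scaled_conj_le_iff[OF m] by (simp add: \<psi>_def)
  obtain vk where vk: "scaled_conj \<omega> m k = ereal vk"
    using k scaled_conj_nonneg[of \<omega> m k] assms(3) by (cases "scaled_conj \<omega> m k") auto
  show ?thesis
    using k vj vk real by (simp add: order_weight_def flip: exp_add)
\<comment> \<open>An infinite conjugate makes the left-hand weight 0; the value -\<infinity> is
  excluded by nonnegativity.\<close>
qed (use scaled_conj_nonneg[of \<omega> m "j + k"] assms(3) in \<open>auto simp: order_weight_def\<close>)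

text \<open>Condition (\<open>\<alpha>\<close>) absorbs a factor \<open>2\<^sup>k\<close>: replace \<open>t\<close> by \<open>t + ln 2\<close> in the supremum defining
  \<open>m \<phi>\<^sup>*(k/m)\<close>.\<close>

lemma order_weight_doubling:
  assumes m: "m \<ge> 1" "m' \<ge> 1" and K: "K \<ge> 1" "\<And>t. t \<ge> 0 \<Longrightarrow> \<omega> (2 * t) \<le> K * (1 + \<omega> t)"
    and m': "K * real m \<le> real m'" and nonneg: "\<And>t. t \<ge> 0 \<Longrightarrow> 0 \<le> \<omega> t" and "\<omega> 1 = 0"
  shows "2 ^ k * order_weight \<omega> m k \<le> exp (real m') * order_weight \<omega> m' k"
proof (cases "scaled_conj \<omega> m k")
  case (real v)
  have "real k * t - real m' * \<omega> (exp t) \<le> real m' + v - real k * ln 2" if "t \<ge> 0" for t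
  proof -
    have "real k * (t + ln 2) - real m * \<omega> (exp (t + ln 2)) \<le> v"
      using scaled_conj_le_iff[OF m(1), of \<omega> k v] real that by auto
    \<comment> \<open>Condition (\<alpha>) applies at \<open>exp t\<close>, as exp(t + ln 2) = 2 exp
      t. Its summand 1, multiplied by K m \<le> m', is the origin of the constant
      \<open>exp (real m')\<close>.\<close>
    moreover have "real m * \<omega> (exp (t + ln 2)) \<le> real m * (K * (1 + \<omega> (exp t)))"
      using K(2)[of "exp t"] by (intro mult_left_mono) (auto simp: exp_add mult.commute)
    moreover have "(K * real m) * (1 + \<omega> (exp t)) \<le> real m' * (1 + \<omega> (exp t))"
      using m' nonneg[of "exp t"] by (intro mult_right_mono) auto
    ultimately show ?thesis by (simp add: algebra_simps)
  qed
  then have le: "scaled_conj \<omega> m' k \<le> ereal (real m' + v - real k * ln 2)"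
    unfolding scaled_conj_le_iff[OF m(2)] by blast
  obtain v' where v': "scaled_conj \<omega> m' k = ereal v'"
    using le scaled_conj_nonneg[of \<omega> m' k] assms(7) by (cases "scaled_conj \<omega> m' k") auto
  have "2 ^ k * exp (- v) = exp (real k * ln 2 - v)"
    by (simp add: exp_diff exp_minus exp_of_nat_mult field_simps)
  also have "\<dots> \<le> exp (real m' - v')"
    using le v' by simp
  finally show ?thesis
    using real v' by (simp add: order_weight_def exp_diff exp_minus field_simps)
qed (use scaled_conj_nonneg[of \<omega> m k] assms(7) in \<open>auto simp: order_weight_def\<close>)

section \<open>The norms in terms of lists and the norm of a product\<close>

lemma O_norm_eq:
  fixes f :: "real^'n \<Rightarrow> complex"
  assumes "\<omega> 1 = 0" "smooth f"
  shows "O_norm \<omega> m n f = (SUP js. SUP x. ennreal (norm (iter_partial_deriv js f x) *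
    (exp (- real n * \<omega> (norm x)) * order_weight \<omega> m (length js))))"
proof -
  \<comment> \<open>The supremum depends on \<alpha> only through the pair of order and derivative;
    as a function \<open>G\<close> of that pair it can be reindexed by
    \<open>range_multi_deriv\<close>.\<close>
  define G where "G = (\<lambda>(k, h :: real^'n \<Rightarrow> complex). SUP x. ennreal (norm (h x) *
    (exp (- real n * \<omega> (norm x)) * order_weight \<omega> m k)))"
  have "O_norm \<omega> m n f = (SUP \<alpha>. G (multi_order \<alpha>, multi_deriv \<alpha> f))"
    unfolding O_norm_def G_def
    unfolding scaled_conj_def[symmetric] ereal_exp_scaled_conj[where \<omega>=\<omega>, OF assms(1)]
    by (simp add: ennreal_mult order_weight_nonneg)
  also have "\<dots> = Sup (G ` (\<lambda>\<alpha>. (multi_order \<alpha>, multi_deriv \<alpha> f)) ` UNIV)"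
    by (simp only: image_image)
  also have "\<dots> = (SUP js. G (length js, iter_partial_deriv js f))"
    by (simp only: range_multi_deriv[OF assms(2)] image_image)
  finally show ?thesis
    by (simp add: G_def)
qed

lemma O_norm_le_iff:
  assumes "\<omega> 1 = 0" "smooth f" "C \<ge> 0"
  shows "O_norm \<omega> m n f \<le> ennreal C \<longleftrightarrow> (\<forall>js x. norm (iter_partial_deriv js f x) *
    (exp (- real n * \<omega> (norm x)) * order_weight \<omega> m (length js)) \<le> C)"
  using assms by (simp add: O_norm_eq SUP_le_iff ennreal_le_iff)

text \<open>The shifts \<open>p\<close> and \<open>q\<close> count the derivatives that the induction has already moved onto \<open>f\<close> and \<open>g\<close>;
  thus no Leibniz sum has to be written down.\<close>

lemma norm_iter_partial_deriv_mult_le: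
  assumes f: "smooth f" "\<And>us. norm (iter_partial_deriv us f x) * a (length us + p) \<le> F"
    and g: "smooth g" "\<And>us. norm (iter_partial_deriv us g x) * a (length us + q) \<le> G"
    and a: "\<And>k. 0 \<le> (a k :: real)" "\<And>j k. a (j + k) \<le> a j * a k"
  shows "norm (iter_partial_deriv js (\<lambda>x. f x * g x) x) * a (length js + p + q) \<le> 2 ^ length js * (F * G)"
  using f g
\<comment> \<open>The last list entry is the first derivative to act on the product. Reverse
  induction therefore meets the product rule at once; each of the two resulting products falls under
  the induction hypothesis with \<open>q\<close> or \<open>p\<close> raised by one.\<close>
proof (induction js arbitrary: f g p q rule: rev_induct)
  case Nil
  have "norm (f x * g x) * a (p + q) \<le> norm (f x * g x) * (a p * a q)"
    by (intro mult_left_mono a) auto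
  also have "\<dots> = (norm (f x) * a p) * (norm (g x) * a q)"
    by (simp add: norm_mult)
  also have "\<dots> \<le> F * G"
    using Nil.prems(2)[of "[]"] Nil.prems(4)[of "[]"] a(1)
    by (intro mult_mono) (auto intro: order_trans[rotated])
  finally show ?case by simp
next
  case (snoc j js)
  note smooth = snoc.prems(1,3) smooth_partial_deriv[OF snoc.prems(1), of j]
    smooth_partial_deriv[OF snoc.prems(3), of j]
  have f': "norm (iter_partial_deriv us (partial_deriv j f) x) * a (length us + Suc p) \<le> F" for us
    using snoc.prems(2)[of "us @ [j]"] by (simp add: iter_partial_deriv_snoc)
  have g': "norm (iter_partial_deriv us (partial_deriv j g) x) * a (length us + Suc q) \<le> G" for us
    using snoc.prems(4)[of "us @ [j]"] by (simp add: iter_partial_deriv_snoc)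
  define A where "A = norm (iter_partial_deriv js (\<lambda>x. f x * partial_deriv j g x) x)"
  define B where "B = norm (iter_partial_deriv js (\<lambda>x. partial_deriv j f x * g x) x)"
  have "norm (iter_partial_deriv (js @ [j]) (\<lambda>x. f x * g x) x) \<le> A + B"
    by (simp add: iter_partial_deriv_snoc partial_deriv_mult iter_partial_deriv_add smooth
        smooth_mult A_def B_def norm_triangle_ineq)
  then have "norm (iter_partial_deriv (js @ [j]) (\<lambda>x. f x * g x) x) * a (Suc (length js + p + q))
      \<le> (A + B) * a (Suc (length js + p + q))"
    by (intro mult_right_mono a)
  moreover have "A * a (Suc (length js + p + q)) \<le> 2 ^ length js * (F * G)"
    using snoc.IH[OF smooth(1) snoc.prems(2) smooth(4) g'] by (simp add: A_def)
  moreover have "B * a (Suc (length js + p + q)) \<le> 2 ^ length js * (F * G)"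
    using snoc.IH[OF smooth(3) f' smooth(2) snoc.prems(4)] by (simp add: B_def)
  ultimately show ?case by (simp add: distrib_right)
qed

text \<open>At a fixed point \<open>x\<close> the factors exp(n \<omega>) and exp(n' \<omega>) are
  moved into the bounds for \<open>f\<close> and \<open>g\<close>, and their product accounts for
  the index \<open>n + n'\<close>. What remains is the Leibniz estimate with weights of index
  \<open>m'\<close> and no shifts, followed by the passage from \<open>m'\<close> to
  \<open>m\<close>.\<close>

lemma O_norm_mult_le:
  assumes m: "m \<ge> 1" "m' \<ge> 1" and K: "K \<ge> 1" "\<And>t. t \<ge> 0 \<Longrightarrow> \<omega> (2 * t) \<le> K * (1 + \<omega> t)"
    and m': "K * real m \<le> real m'" and nonneg: "\<And>t. t \<ge> 0 \<Longrightarrow> 0 \<le> \<omega> t" and \<omega>1: "\<omega> 1 = 0"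
    and f: "f \<in> O_step \<omega> m' n" and g: "g \<in> O_step \<omega> m' n'"
  shows "O_norm \<omega> m (n + n') (\<lambda>x. f x * g x)
    \<le> ennreal (exp (real m')) * O_norm \<omega> m' n f * O_norm \<omega> m' n' g"
proof -
  obtain F where F: "F \<ge> 0" "O_norm \<omega> m' n f = ennreal F"
    using f by (cases "O_norm \<omega> m' n f") (auto simp: O_step_def)
  obtain G where G: "G \<ge> 0" "O_norm \<omega> m' n' g = ennreal G"
    using g by (cases "O_norm \<omega> m' n' g") (auto simp: O_step_def)
  have sm: "smooth f" "smooth g"
    using f g by (auto simp: O_step_def)
  have fF: "norm (iter_partial_deriv js f x) * (exp (- real n * \<omega> (norm x)) * order_weight \<omega> m' (length js)) \<le> F"
    for js x using O_norm_le_iff[of \<omega> f F m' n] F sm \<omega>1 by auto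
  have gG: "norm (iter_partial_deriv js g x) * (exp (- real n' * \<omega> (norm x)) * order_weight \<omega> m' (length js)) \<le> G"
    for js x using O_norm_le_iff[of \<omega> g G m' n'] G sm \<omega>1 by auto
  have "norm (iter_partial_deriv js (\<lambda>x. f x * g x) x) *
      (exp (- real (n + n') * \<omega> (norm x)) * order_weight \<omega> m (length js)) \<le> exp (real m') * F * G"
    for js x
  proof -
    define e e' D k where "e = exp (real n * \<omega> (norm x))" and "e' = exp (real n' * \<omega> (norm x))"
      and "D = norm (iter_partial_deriv js (\<lambda>x. f x * g x) x)" and "k = length js"
    have pos: "e > 0" "e' > 0" "D \<ge> 0" by (auto simp: e_def e'_def D_def)
    have "D * order_weight \<omega> m' (length js + 0 + 0) \<le> 2 ^ length js * ((e * F) * (e' * G))"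
      unfolding D_def
    proof (rule norm_iter_partial_deriv_mult_le)
      show "norm (iter_partial_deriv us f x) * order_weight \<omega> m' (length us + 0) \<le> e * F" for us
        using fF[of us x] by (simp add: e_def exp_minus field_simps)
      show "norm (iter_partial_deriv us g x) * order_weight \<omega> m' (length us + 0) \<le> e' * G" for us
        using gG[of us x] by (simp add: e'_def exp_minus field_simps)
    qed (use sm order_weight_nonneg order_weight_add_le[where \<omega>=\<omega>, OF m(2) nonneg \<omega>1] in auto)
    then have D: "D * order_weight \<omega> m' k \<le> 2 ^ k * (e * F * (e' * G))"
      by (simp add: k_def)
    \<comment> \<open>The factor \<open>2 ^ k\<close> gained from
      \<open>order_weight_doubling\<close> is the one lost in the Leibniz estimate, so the two
      cancel.\<close>
    have "2 ^ k * (D * order_weight \<omega> m k) \<le> D * (exp (real m') * order_weight \<omega> m' k)"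
      using mult_left_mono[OF order_weight_doubling[OF m K m' nonneg \<omega>1, of k] pos(3)]
      by (simp add: mult_ac)
    also have "\<dots> \<le> exp (real m') * (2 ^ k * (e * F * (e' * G)))"
      using mult_left_mono[OF D, of "exp (real m')"] by (simp add: mult_ac)
    finally have "2 ^ k * (D * order_weight \<omega> m k) \<le> 2 ^ k * (exp (real m') * (e * F * (e' * G)))"
      by (simp add: mult_ac)
    then have "D * order_weight \<omega> m k \<le> exp (real m') * (e * F * (e' * G))"
      by simp
    moreover have ee: "exp (- real (n + n') * \<omega> (norm x)) = 1 / (e * e')"
      by (simp add: e_def e'_def exp_minus field_simps flip: exp_add)
    ultimately show ?thesis
      unfolding ee D_def[symmetric] k_def[symmetric] using pos by (simp add: field_simps)
  qed
  then have "O_norm \<omega> m (n + n') (\<lambda>x. f x * g x) \<le> ennreal (exp (real m') * F * G)"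
    using F G sm \<omega>1 by (subst O_norm_le_iff) (auto intro: smooth_mult)
  then show ?thesis
    using F G by (simp add: ennreal_mult)
qed


section \<open>Continuity of linear maps between limits\<close>

definition function_subspace :: "('a \<Rightarrow> complex) set \<Rightarrow> bool" where
  "function_subspace X \<longleftrightarrow> (\<lambda>x. 0) \<in> X \<and> (\<forall>f\<in>X. \<forall>g\<in>X. (\<lambda>x. f x + g x) \<in> X) \<and>
     (\<forall>c. \<forall>f\<in>X. (\<lambda>x. c * f x) \<in> X)"

lemma function_subspaceD:
  assumes "function_subspace X"
  shows "(\<lambda>x. 0) \<in> X" "f \<in> X \<Longrightarrow> g \<in> X \<Longrightarrow> (\<lambda>x. f x + g x) \<in> X" "f \<in> X \<Longrightarrow> (\<lambda>x. c * f x) \<in> X"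
  using assms by (auto simp: function_subspace_def)

lemma function_subspace_diff:
  assumes "function_subspace X" "f \<in> X" "g \<in> X"
  shows "(\<lambda>x. f x - g x) \<in> X"
  using function_subspaceD(2)[OF assms(1,2) function_subspaceD(3)[OF assms(1,3), of "-1"]] by simp

text \<open>Directedness puts any two elements of the union into a common member, where their sum
  can be formed.\<close>

lemma function_subspace_Union_chain:
  assumes "I \<noteq> {}" "\<And>n. n \<in> I \<Longrightarrow> function_subspace (X n)"
    and "\<And>m n. m \<in> I \<Longrightarrow> n \<in> I \<Longrightarrow> \<exists>k\<in>I. X m \<union> X n \<subseteq> X k"
  shows "function_subspace (\<Union>n\<in>I. X n)"
  unfolding function_subspace_def
proof (intro conjI ballI allI)
  fix f g assume "f \<in> (\<Union>n\<in>I. X n)" "g \<in> (\<Union>n\<in>I. X n)"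
  then obtain k where "k \<in> I" "f \<in> X k" "g \<in> X k"
    using assms(3) by (metis UN_E Un_iff subsetD)
  then show "(\<lambda>x. f x + g x) \<in> (\<Union>n\<in>I. X n)"
    using assms(2) function_subspaceD(2) by blast
qed (use assms(1,2) function_subspaceD(1,3) in blast)+

text \<open>The pullback along a constant map to a one-point space is the indiscrete topology on
  \<open>X\<close>. It serves as a competitor that always exists in the definition of the inductive
  limit.\<close>

lemma locally_convex_topology_indiscrete:
  assumes X: "function_subspace X"
  shows "locally_convex_topology (pullback_topology X (\<lambda>_. ()) (discrete_topology UNIV))" (is "locally_convex_topology ?T")
proof -
  have top: "topspace ?T = X"
    by (simp add: topspace_pullback_topology)
  have cont: "continuous_map Z ?T h" if "h ` topspace Z \<subseteq> X" for Z :: "'c topology" and h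
    using that by (intro continuous_map_pullback') (auto simp: continuous_map_def)
  show ?thesis
    unfolding locally_convex_topology_def
  proof (intro conjI allI impI)
    show "(\<lambda>x. 0) \<in> topspace ?T"
      using function_subspaceD(1)[OF X] top by simp
    show "continuous_map (prod_topology ?T ?T) ?T (\<lambda>(f, g) x. f x + g x)"
      "continuous_map (prod_topology euclidean ?T) ?T (\<lambda>(c, f) x. c * f x)"
      by (auto intro!: cont intro: function_subspaceD[OF X] simp: top)
    fix U assume "openin ?T U \<and> (\<lambda>x. 0) \<in> U"
    then have "U = X"
      by (auto simp: openin_pullback_topology split: if_splits)
    then show "\<exists>W. openin ?T W \<and> (\<lambda>x. 0) \<in> W \<and> W \<subseteq> U \<and>
        (\<forall>f\<in>W. \<forall>g\<in>W. \<forall>u\<in>{0..1::real}. (\<lambda>x. of_real (1 - u) * f x + of_real u * g x) \<in> W)"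
      using openin_topspace[of ?T] unfolding top
      by (intro exI[of _ X] conjI ballI function_subspaceD[OF X]) auto
  qed
qed

locale linear_on_functions =
  fixes X :: "('a \<Rightarrow> complex) set" and L :: "('a \<Rightarrow> complex) \<Rightarrow> 'b \<Rightarrow> complex"
  assumes subspace: "function_subspace X"
    and L_add: "f \<in> X \<Longrightarrow> g \<in> X \<Longrightarrow> L (\<lambda>x. f x + g x) = (\<lambda>x. L f x + L g x)"
    and L_scale: "f \<in> X \<Longrightarrow> L (\<lambda>x. c * f x) = (\<lambda>x. c * L f x)"
begin

lemma L_zero: "L (\<lambda>x. 0) = (\<lambda>x. 0)"
  using L_scale[OF function_subspaceD(1)[OF subspace], of 0] by simp

lemma L_diff:
  assumes "f \<in> X" "g \<in> X"
  shows "L (\<lambda>x. f x - g x) = (\<lambda>x. L f x - L g x)"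
  using L_add[OF assms(1) function_subspaceD(3)[OF subspace assms(2), of "-1"]]
    L_scale[OF assms(2), of "-1"] by simp

text \<open>A map into the pullback is continuous as soon as its composition with \<open>L\<close>
  is, and \<open>L\<close> intertwines the vector space operations; so their continuity is inherited
  from \<open>S\<close>. Preimages of convex neighbourhoods of 0 under \<open>L\<close> are again
  convex neighbourhoods of 0.\<close>

lemma locally_convex_topology_pullback:
  assumes S: "locally_convex_topology S" and L: "L ` X \<subseteq> topspace S"
  shows "locally_convex_topology (pullback_topology X L S)" (is "locally_convex_topology ?T")
proof -
  have top: "topspace ?T = X"
    using L by (auto simp: topspace_pullback_topology)
  have contL: "continuous_map ?T S L"
    using continuous_map_pullback[OF continuous_map_id, of X L S] by simp
  show ?thesis
    unfolding locally_convex_topology_def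
  proof (intro conjI allI impI)
    show "(\<lambda>x. 0) \<in> topspace ?T"
      using function_subspaceD(1)[OF subspace] top by simp
    show "continuous_map (prod_topology ?T ?T) ?T (\<lambda>(f, g) x. f x + g x)"
    proof (rule continuous_map_pullback')
      \<comment> \<open>By additivity, \<open>L\<close> after addition is addition in
        \<open>S\<close> after applying \<open>L\<close> to both components, and the latter
        composition is visibly continuous.\<close>
      have "continuous_map (prod_topology ?T ?T) S
          ((\<lambda>(f, g) x. f x + g x) \<circ> (\<lambda>p. (L (fst p), L (snd p))))"
      proof (rule continuous_map_compose)
        show "continuous_map (prod_topology ?T ?T) (prod_topology S S) (\<lambda>p. (L (fst p), L (snd p)))"
          by (intro continuous_map_pairedI
              continuous_map_compose[OF continuous_map_fst contL, unfolded o_def]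
              continuous_map_compose[OF continuous_map_snd contL, unfolded o_def])
      qed (use S in \<open>simp add: locally_convex_topology_def\<close>)
      then show "continuous_map (prod_topology ?T ?T) S (L \<circ> (\<lambda>(f, g) x. f x + g x))"
        by (rule continuous_map_eq) (auto simp: top L_add)
    qed (auto simp: top intro: function_subspaceD[OF subspace])
    show "continuous_map (prod_topology euclidean ?T) ?T (\<lambda>(c, f) x. c * f x)"
    proof (rule continuous_map_pullback')
      have "continuous_map (prod_topology euclidean ?T) S
          ((\<lambda>(c, f) x. c * f x) \<circ> (\<lambda>p. (fst p, L (snd p))))"
      proof (rule continuous_map_compose)
        show "continuous_map (prod_topology euclidean ?T) (prod_topology euclidean S)
            (\<lambda>p. (fst p, L (snd p)))"
          by (intro continuous_map_pairedI continuous_map_fst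
              continuous_map_compose[OF continuous_map_snd contL, unfolded o_def])
      qed (use S in \<open>simp add: locally_convex_topology_def\<close>)
      then show "continuous_map (prod_topology euclidean ?T) S (L \<circ> (\<lambda>(c, f) x. c * f x))"
        by (rule continuous_map_eq) (auto simp: top L_scale)
    qed (auto simp: top intro: function_subspaceD[OF subspace])
    fix U assume "openin ?T U \<and> (\<lambda>x. 0) \<in> U"
    then obtain V where V: "openin S V" "U = L -` V \<inter> X" "(\<lambda>x. 0) \<in> V"
      by (auto simp: openin_pullback_topology L_zero)
    then obtain W where W: "openin S W" "(\<lambda>x. 0) \<in> W" "W \<subseteq> V"
      "\<And>f g u. f \<in> W \<Longrightarrow> g \<in> W \<Longrightarrow> u \<in> {0..1::real} \<Longrightarrow>
        (\<lambda>x. of_real (1 - u) * f x + of_real u * g x) \<in> W"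
      using S unfolding locally_convex_topology_def by (elim conjE allE[of _ V]) blast
    have L_comb: "L (\<lambda>x. a * f x + b * g x) = (\<lambda>x. a * L f x + b * L g x)"
      if "f \<in> X" "g \<in> X" for a b f g
      using that by (simp add: L_add L_scale function_subspaceD[OF subspace])
    show "\<exists>W. openin ?T W \<and> (\<lambda>x. 0) \<in> W \<and> W \<subseteq> U \<and>
        (\<forall>f\<in>W. \<forall>g\<in>W. \<forall>u\<in>{0..1::real}. (\<lambda>x. of_real (1 - u) * f x + of_real u * g x) \<in> W)"
    proof (intro exI[of _ "L -` W \<inter> X"] conjI ballI)
      show "openin ?T (L -` W \<inter> X)"
        using W(1) by (auto simp: openin_pullback_topology)
      show "(\<lambda>x. 0) \<in> L -` W \<inter> X"
        using W(2) function_subspaceD(1)[OF subspace] by (simp add: L_zero)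
      show "L -` W \<inter> X \<subseteq> U"
        using V(2) W(3) by blast
      fix f g and u :: real
      assume fg: "f \<in> L -` W \<inter> X" "g \<in> L -` W \<inter> X" and u: "u \<in> {0..1}"
      then have "L (\<lambda>x. of_real (1 - u) * f x + of_real u * g x) \<in> W"
        using W(4)[of "L f" "L g" u] by (subst L_comb) auto
      moreover have "(\<lambda>x. of_real (1 - u) * f x + of_real u * g x) \<in> X"
        using fg by (intro function_subspaceD(2,3)[OF subspace]) auto
      ultimately show "(\<lambda>x. of_real (1 - u) * f x + of_real u * g x) \<in> L -` W \<inter> X"
        by blast
    qed
  qed
qed

end

section \<open>Inductive limits\<close>

text \<open>That the whole union is reached requires at least one competing topology. The indiscrete
  one qualifies, since every map into it is continuous, and it makes the union itself a
  generator.\<close>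

lemma topspace_lc_inductive_limit:
  assumes "function_subspace (\<Union>n\<in>I. topspace (T n))"
  shows "topspace (lc_inductive_limit I T) = (\<Union>n\<in>I. topspace (T n))"
proof
  let ?X = "\<Union>n\<in>I. topspace (T n)"
  let ?S = "pullback_topology ?X (\<lambda>_. ()) (discrete_topology UNIV)"
  show "topspace (lc_inductive_limit I T) \<subseteq> ?X"
    unfolding lc_inductive_limit_def topology_generated_by_topspace
    by (intro Union_least, elim CollectE exE conjE) (metis openin_subset)
  have "continuous_map (T n) ?S (\<lambda>f. f)" if "n \<in> I" for n
    using that by (intro continuous_map_pullback') (auto simp: continuous_map_def)
  moreover have "topspace ?S = ?X"
    by (simp add: topspace_pullback_topology)
  moreover have "openin ?S ?X"
    using openin_topspace[of ?S] by (simp add: topspace_pullback_topology)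
  ultimately have "?X \<in> {U. \<exists>S. locally_convex_topology S \<and> topspace S = ?X \<and>
      (\<forall>n\<in>I. continuous_map (T n) S (\<lambda>f. f)) \<and> openin S U}"
    using locally_convex_topology_indiscrete[OF assms] by (intro CollectI exI[of _ ?S] conjI ballI)
  then show "?X \<subseteq> topspace (lc_inductive_limit I T)"
    unfolding lc_inductive_limit_def topology_generated_by_topspace by (rule Union_upper)
qed

text \<open>A linear map pulls every competing locally convex topology on the target back to one on the
  source.\<close>

lemma continuous_map_lc_inductive_limit:
  assumes "linear_on_functions (\<Union>n\<in>I. topspace (T n)) L"
    and Y: "function_subspace (\<Union>n\<in>J. topspace (T' n))"
    and L: "\<And>n. n \<in> I \<Longrightarrow> \<exists>n'\<in>J. continuous_map (T n) (T' n') L"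
  shows "continuous_map (lc_inductive_limit I T) (lc_inductive_limit J T') L"
proof -
  interpret linear_on_functions "\<Union>n\<in>I. topspace (T n)" L by fact
  let ?X = "\<Union>n\<in>I. topspace (T n)" and ?Y = "\<Union>n\<in>J. topspace (T' n)"
  have im: "L ` ?X \<subseteq> ?Y"
  proof (clarify)
    fix f n assume "n \<in> I" "f \<in> topspace (T n)"
    then show "L f \<in> ?Y"
      using L[of n] by (auto simp: continuous_map_def Pi_iff)
  qed
  note top = topspace_lc_inductive_limit[OF subspace] topspace_lc_inductive_limit[OF Y]
  show ?thesis
    unfolding lc_inductive_limit_def[of J T']
  proof (rule continuous_on_generated_topo)
    fix U assume "U \<in> {U. \<exists>S. locally_convex_topology S \<and> topspace S = ?Y \<and>
      (\<forall>n\<in>J. continuous_map (T' n) S (\<lambda>f. f)) \<and> openin S U}"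
    then obtain S where S: "locally_convex_topology S" "topspace S = ?Y" "openin S U"
      "\<And>n. n \<in> J \<Longrightarrow> continuous_map (T' n) S (\<lambda>f. f)" by blast
    let ?P = "pullback_topology ?X L S"
    \<comment> \<open>The pullback \<open>?P\<close> competes on the source: the inclusion of
      \<open>T n\<close> followed by \<open>L\<close> factors through some \<open>T' n'\<close>,
      whose inclusion into \<open>S\<close> is continuous.\<close>
    have "continuous_map (T n) ?P (\<lambda>f. f)" if n: "n \<in> I" for n
    proof (rule continuous_map_pullback')
      obtain n' where "n' \<in> J" "continuous_map (T n) (T' n') L"
        using L[OF n] by blast
      then show "continuous_map (T n) S (L \<circ> (\<lambda>f. f))"
        using continuous_map_compose[OF _ S(4)] unfolding o_def by blast
    qed (use n in auto)
    moreover have "locally_convex_topology ?P"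
      using locally_convex_topology_pullback S(1,2) im by blast
    moreover have "topspace ?P = ?X"
      using im S(2) unfolding topspace_pullback_topology by blast
    moreover have "openin ?P (L -` U \<inter> ?X)"
      using S(3) by (auto simp: openin_pullback_topology)
    ultimately have "openin (lc_inductive_limit I T) (L -` U \<inter> ?X)"
      unfolding lc_inductive_limit_def by (intro topology_generated_by_Basis) blast
    then show "openin (lc_inductive_limit I T) (L -` U \<inter> topspace (lc_inductive_limit I T))"
      by (simp only: top)
  next
    show "L ` topspace (lc_inductive_limit I T) \<subseteq> \<Union> {U. \<exists>S. locally_convex_topology S \<and>
      topspace S = ?Y \<and> (\<forall>n\<in>J. continuous_map (T' n) S (\<lambda>f. f)) \<and> openin S U}"
      using im top unfolding lc_inductive_limit_def[of J T'] topology_generated_by_topspace by simp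
  qed
qed

section \<open>Projective limits\<close>

text \<open>For an empty index set there are no generators, whereas the intersection would be the
  whole type; hence the assumption on \<open>I\<close>.\<close>

lemma topspace_projective_limit:
  assumes "I \<noteq> {}"
  shows "topspace (projective_limit I T) = (\<Inter>m\<in>I. topspace (T m))"
proof
  obtain m where m: "m \<in> I"
    using assms by blast
  have "topspace (T m) \<inter> (\<Inter>m\<in>I. topspace (T m)) \<in> {U \<inter> (\<Inter>m\<in>I. topspace (T m)) | U m. m \<in> I \<and> openin (T m) U}"
    using m by blast
  then show "(\<Inter>m\<in>I. topspace (T m)) \<subseteq> topspace (projective_limit I T)"
    unfolding projective_limit_def topology_generated_by_topspace using m by blast
  show "topspace (projective_limit I T) \<subseteq> (\<Inter>m\<in>I. topspace (T m))"
    unfolding projective_limit_def topology_generated_by_topspace by blast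
qed

text \<open>A generator on the target comes from an open set of a single \<open>T m\<close>. Its
  preimage is open in the corresponding \<open>T m'\<close>, so its trace on the intersection is a
  generator on the source.\<close>

lemma continuous_map_projective_limit:
  assumes L: "\<And>m. m \<in> I \<Longrightarrow> \<exists>m'\<in>I. continuous_map (T m') (T m) L"
  shows "continuous_map (projective_limit I T) (projective_limit I T) L"
proof (cases "I = {}")
  case False
  note top = topspace_projective_limit[OF False]
  have im: "L ` (\<Inter>m\<in>I. topspace (T m)) \<subseteq> (\<Inter>m\<in>I. topspace (T m))"
    using L by (auto simp: continuous_map_def Pi_iff)
  show ?thesis
    unfolding projective_limit_def[of I T]
  proof (rule continuous_on_generated_topo, unfold projective_limit_def[symmetric])
    fix V assume "V \<in> {U \<inter> (\<Inter>m\<in>I. topspace (T m)) | U m. m \<in> I \<and> openin (T m) U}"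
    then obtain U m where V: "V = U \<inter> (\<Inter>m\<in>I. topspace (T m))" "m \<in> I" "openin (T m) U" by blast
    obtain m' where m': "m' \<in> I" "continuous_map (T m') (T m) L"
      using L V(2) by blast
    have "openin (T m') (L -` U \<inter> topspace (T m'))"
      using m'(2) V(3) by (auto simp: continuous_map_alt)
    then have "openin (projective_limit I T)
        (L -` U \<inter> topspace (T m') \<inter> (\<Inter>m\<in>I. topspace (T m)))"
      unfolding projective_limit_def using m'(1) by (intro topology_generated_by_Basis) blast
    moreover have "L -` U \<inter> topspace (T m') \<inter> (\<Inter>m\<in>I. topspace (T m))
        = L -` V \<inter> topspace (projective_limit I T)"
      using im m'(1) V(1) by (auto simp: top)
    ultimately show "openin (projective_limit I T) (L -` V \<inter> topspace (projective_limit I T))"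
      by simp
  next
    show "L ` topspace (projective_limit I T)
      \<subseteq> \<Union> {U \<inter> (\<Inter>m\<in>I. topspace (T m)) | U m. m \<in> I \<and> openin (T m) U}"
      unfolding topology_generated_by_topspace[symmetric] projective_limit_def[symmetric] top
      by (fact im)
  qed
qed (simp add: projective_limit_def continuous_map_alt)

section \<open>Normed steps\<close>

lemma topspace_norm_topology:
  assumes "r (\<lambda>x. 0) = 0"
  shows "topspace (norm_topology X r) = X"
proof -
  have "f \<in> {g \<in> X. r (\<lambda>x. g x - f x) < ennreal 1}" if "f \<in> X" for f
    using that assms by simp
  then show ?thesis
    unfolding norm_topology_def topology_generated_by_topspace using zero_less_one by blast
qed

text \<open>The balls are only known to generate the topologies. Around each point of the preimage
  of a target ball a source ball is therefore fitted in, using the bound \<open>C\<close> and the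
  triangle inequality in the target.\<close>

lemma continuous_map_norm_topology:
  assumes "linear_on_functions X L" and Y: "function_subspace Y" and im: "L ` X \<subseteq> Y"
    and r: "r (\<lambda>x. 0) = 0" "\<And>f. f \<in> X \<Longrightarrow> r f < \<infinity>"
    and s: "s (\<lambda>x. 0) = 0" "\<And>f. f \<in> Y \<Longrightarrow> s f < \<infinity>"
      "\<And>f g. f \<in> Y \<Longrightarrow> g \<in> Y \<Longrightarrow> s (\<lambda>x. f x + g x) \<le> s f + s g"
    and C: "C < \<infinity>" "\<And>f. f \<in> X \<Longrightarrow> s (L f) \<le> C * r f"
  shows "continuous_map (norm_topology X r) (norm_topology Y s) L"
proof -
  interpret linear_on_functions X L by fact
  have top: "topspace (norm_topology X r) = X" "topspace (norm_topology Y s) = Y"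
    using r s by (simp_all add: topspace_norm_topology)
  obtain c where c: "C = ennreal c" "c \<ge> 0"
    using C(1) by (cases C) auto
  show ?thesis
    unfolding norm_topology_def[of Y s]
  proof (rule continuous_on_generated_topo)
    fix U assume "U \<in> {{g \<in> Y. s (\<lambda>x. g x - f x) < ennreal \<epsilon>} | f \<epsilon>. f \<in> Y \<and> \<epsilon> > 0}"
    then obtain f \<epsilon> where U: "U = {g \<in> Y. s (\<lambda>x. g x - f x) < ennreal \<epsilon>}" "f \<in> Y" "\<epsilon> > 0" by blast
    have "\<exists>B. openin (norm_topology X r) B \<and> h \<in> B \<and> B \<subseteq> L -` U \<inter> X" if h: "h \<in> L -` U \<inter> X" for h
    proof -
      have hX: "h \<in> X" and hY: "L h \<in> Y" and hU: "s (\<lambda>x. L h x - f x) < ennreal \<epsilon>"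
        using h U by auto
      obtain d where d: "s (\<lambda>x. L h x - f x) = ennreal d" "d \<ge> 0" "d < \<epsilon>"
        using hU U(3) by (cases "s (\<lambda>x. L h x - f x)") (auto simp: ennreal_less_iff)
      \<comment> \<open>The remaining distance to the boundary of the target ball is \<epsilon> - d.
        Dividing by \<open>c + 1\<close> instead of \<open>c\<close> covers \<open>c = 0\<close> and
        makes the final inequality strict.\<close>
      define \<eta> where "\<eta> = (\<epsilon> - d) / (c + 1)"
      have \<eta>: "\<eta> > 0" "c * \<eta> + d < \<epsilon>"
        using c(2) d by (auto simp: \<eta>_def field_simps)
      let ?B = "{g \<in> X. r (\<lambda>x. g x - h x) < ennreal \<eta>}"
      have "g \<in> L -` U" if g: "g \<in> ?B" for g
      proof -
        have gX: "g \<in> X" and gY: "L g \<in> Y" using g im by auto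
        have gh: "(\<lambda>x. g x - h x) \<in> X"
          using function_subspace_diff[OF subspace gX hX] .
        have "s (\<lambda>x. L g x - f x) = s (\<lambda>x. L (\<lambda>x. g x - h x) x + (L h x - f x))"
          by (simp add: L_diff[OF gX hX])
        also have "\<dots> \<le> s (L (\<lambda>x. g x - h x)) + s (\<lambda>x. L h x - f x)"
          using im gh hY U(2) by (intro s(3) function_subspace_diff[OF Y]) auto
        also have "\<dots> \<le> C * ennreal \<eta> + ennreal d"
          using g by (intro add_mono order_trans[OF C(2)[OF gh]] mult_left_mono) (auto simp: d)
        also have "\<dots> = ennreal (c * \<eta> + d)"
          using c d \<eta> by (simp add: ennreal_mult)
        also have "\<dots> < ennreal \<epsilon>"
          using \<eta> U(3) by (simp add: ennreal_lessI)
        finally show ?thesis using gY U by simp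
      qed
      moreover have "openin (norm_topology X r) ?B"
        unfolding norm_topology_def using hX \<eta>(1) by (intro topology_generated_by_Basis) blast
      moreover have "h \<in> ?B"
        using hX r(1) \<eta>(1) by simp
      ultimately show ?thesis by blast
    qed
    then have "openin (norm_topology X r) (L -` U \<inter> X)"
      by (subst openin_subopen) blast
    then show "openin (norm_topology X r) (L -` U \<inter> topspace (norm_topology X r))"
      by (simp add: top)
  next
    show "L ` topspace (norm_topology X r)
      \<subseteq> \<Union> {{g \<in> Y. s (\<lambda>x. g x - f x) < ennreal \<epsilon>} | f \<epsilon>. f \<in> Y \<and> \<epsilon> > 0}"
      using im top unfolding norm_topology_def[of Y s] topology_generated_by_topspace by simp
  qed
qed


section \<open>The spaces of multipliers\<close>

context
  fixes \<omega> :: "real \<Rightarrow> real"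
  assumes \<omega>1: "\<omega> 1 = 0" and \<omega>_nonneg: "\<And>t. t \<ge> 0 \<Longrightarrow> 0 \<le> \<omega> t"
begin

lemma O_norm_zero: "O_norm \<omega> m n (\<lambda>x. 0) = 0"
  by (simp add: O_norm_eq[where \<omega>=\<omega>, OF \<omega>1] smooth_const iter_partial_deriv_const)

lemma O_norm_triangle:
  assumes "smooth f" "smooth g"
  shows "O_norm \<omega> m n (\<lambda>x. f x + g x) \<le> O_norm \<omega> m n f + O_norm \<omega> m n g"
proof -
  have "ennreal (norm (iter_partial_deriv js (\<lambda>x. f x + g x) x) *
      (exp (- real n * \<omega> (norm x)) * order_weight \<omega> m (length js)))
      \<le> O_norm \<omega> m n f + O_norm \<omega> m n g" (is "ennreal (_ * ?w) \<le> _") for js x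
  proof -
    have w: "0 \<le> norm z * ?w" for z :: complex
      by (simp add: order_weight_nonneg)
    have "norm (iter_partial_deriv js (\<lambda>x. f x + g x) x) * ?w
        \<le> norm (iter_partial_deriv js f x) * ?w + norm (iter_partial_deriv js g x) * ?w"
      unfolding distrib_right[symmetric] iter_partial_deriv_add[OF assms]
      by (intro mult_right_mono norm_triangle_ineq mult_nonneg_nonneg order_weight_nonneg) auto
    then have "ennreal (norm (iter_partial_deriv js (\<lambda>x. f x + g x) x) * ?w)
        \<le> ennreal (norm (iter_partial_deriv js f x) * ?w) + ennreal (norm (iter_partial_deriv js g x) * ?w)"
      unfolding ennreal_plus[OF w w, symmetric] by (rule ennreal_leI)
    also have "\<dots> \<le> O_norm \<omega> m n f + O_norm \<omega> m n g"
      unfolding O_norm_eq[where \<omega>=\<omega>, OF \<omega>1 assms(1)] O_norm_eq[where \<omega>=\<omega>, OF \<omega>1 assms(2)]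
      by (intro add_mono SUP_upper2[of js] SUP_upper2[of x]) auto
    finally show ?thesis .
  qed
  then show ?thesis
    unfolding O_norm_eq[where \<omega>=\<omega>, OF \<omega>1 smooth_add[OF assms]] by (intro SUP_least)
qed

lemma O_norm_cmult_le:
  assumes "smooth f"
  shows "O_norm \<omega> m n (\<lambda>x. c * f x) \<le> ennreal (norm c) * O_norm \<omega> m n f"
proof -
  have "ennreal (norm (iter_partial_deriv js (\<lambda>x. c * f x) x) *
      (exp (- real n * \<omega> (norm x)) * order_weight \<omega> m (length js)))
      \<le> ennreal (norm c) * O_norm \<omega> m n f" for js x
    unfolding O_norm_eq[where \<omega>=\<omega>, OF \<omega>1 assms] iter_partial_deriv_cmult[OF assms] norm_mult
      mult.assoc[of "norm c"] ennreal_mult'[OF norm_ge_zero]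
    by (intro mult_left_mono SUP_upper2[of js] SUP_upper2[of x]) auto
  then show ?thesis
    unfolding O_norm_eq[where \<omega>=\<omega>, OF \<omega>1 smooth_mult[OF smooth_const assms]] by (intro SUP_least)
qed

lemma O_norm_antimono:
  fixes f :: "real^'n \<Rightarrow> complex"
  assumes "smooth f" "n \<le> n'"
  shows "O_norm \<omega> m n' f \<le> O_norm \<omega> m n f"
proof -
  have "exp (- real n' * \<omega> (norm x)) \<le> exp (- real n * \<omega> (norm x))" for x :: "real^'n"
    using mult_right_mono[of "real n" "real n'" "\<omega> (norm x)"] assms(2) \<omega>_nonneg[of "norm x"] by simp
  then show ?thesis
    unfolding O_norm_eq[where \<omega>=\<omega>, OF \<omega>1 assms(1)]
    by (intro SUP_mono' ennreal_leI mult_left_mono mult_right_mono)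
      (simp_all add: order_weight_nonneg)
qed

lemma function_subspace_O_step: "function_subspace (O_step \<omega> m n)"
  unfolding function_subspace_def O_step_def
proof (intro conjI ballI allI CollectI)
  fix f g :: "real^'n \<Rightarrow> complex" and c
  assume "f \<in> {f. smooth f \<and> O_norm \<omega> m n f < \<infinity>}"
  then have f: "smooth f" "O_norm \<omega> m n f < \<infinity>" by auto
  show "O_norm \<omega> m n (\<lambda>x. c * f x) < \<infinity>"
    by (rule le_less_trans[OF O_norm_cmult_le[OF f(1)]]) (use f(2) in \<open>simp add: ennreal_mult_less_top\<close>)
  show "smooth (\<lambda>x. c * f x)"
    using f smooth_const by (intro smooth_mult)
  assume "g \<in> {f. smooth f \<and> O_norm \<omega> m n f < \<infinity>}"
  then have g: "smooth g" "O_norm \<omega> m n g < \<infinity>" by auto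
  show "smooth (\<lambda>x. f x + g x)"
    using f g by (intro smooth_add)
  show "O_norm \<omega> m n (\<lambda>x. f x + g x) < \<infinity>"
    using f(2) g(2) by (intro le_less_trans[OF O_norm_triangle[OF f(1) g(1)]]) simp
qed (simp_all add: O_norm_zero smooth_const)

lemma O_step_mono: "n \<le> n' \<Longrightarrow> O_step \<omega> m n \<subseteq> O_step \<omega> m n'"
  by (auto simp: O_step_def intro: le_less_trans[OF O_norm_antimono])

lemma topspace_O_step_topology [simp]:
  "topspace (norm_topology (O_step \<omega> m n) (O_norm \<omega> m n)) = O_step \<omega> m n"
  by (rule topspace_norm_topology) (rule O_norm_zero)

lemma function_subspace_Union_O_step: "function_subspace (\<Union>n\<in>{1..}. O_step \<omega> m n)"
proof (rule function_subspace_Union_chain)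
  show "\<exists>k\<in>{1..}. O_step \<omega> m n \<union> O_step \<omega> m n' \<subseteq> O_step \<omega> m k" if "n \<in> {1..}" for n n'
    using that by (intro bexI[of _ "max n n'"] Un_least O_step_mono) auto
qed (auto intro: function_subspace_O_step)

lemma topspace_OM_topology: "topspace (OM_topology \<omega>) = (OM_space \<omega> :: (real^'n \<Rightarrow> complex) set)"
proof -
  have "topspace (lc_inductive_limit {1..} (\<lambda>n. norm_topology (O_step \<omega> m n) (O_norm \<omega> m n)))
      = (\<Union>n\<in>{1..}. O_step \<omega> m n :: (real^'n \<Rightarrow> complex) set)" for m
    by (subst topspace_lc_inductive_limit)
      (simp_all only: topspace_O_step_topology function_subspace_Union_O_step)
  note lim = this
  have "{1::nat..} \<noteq> {}" by simp
  note proj = topspace_projective_limit[OF this]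
  show ?thesis
    by (simp only: OM_topology_def OM_space_def proj lim)
qed

text \<open>On a compact set in the ball of radius \<open>R\<close>, monotonicity bounds
  \<omega>(|x|) by \<omega>(R). The growth factor then costs at most the constant exp(n
  \<omega>(R)).\<close>

lemma E_seminorm_finite_if_O_step:
  assumes mono: "mono_on {0..} \<omega>" and f: "f \<in> O_step \<omega> m n" and K: "compact K"
  shows "E_seminorm \<omega> K m f < \<infinity>"
proof -
  obtain R where R: "R \<ge> 0" "\<And>x. x \<in> K \<Longrightarrow> norm x \<le> R"
    using compact_imp_bounded[OF K] by (metis bounded_pos less_imp_le)
  have "ennreal (norm (multi_deriv \<alpha> f x)) * ereal_exp (- (ereal (real m) * young_conj \<omega> (real (multi_order \<alpha>) / real m)))
      \<le> ennreal (exp (real n * \<omega> R)) * O_norm \<omega> m n f" if x: "x \<in> K" for x \<alpha>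
  proof -
    let ?D = "norm (multi_deriv \<alpha> f x)" and ?w = "order_weight \<omega> m (multi_order \<alpha>)"
    have "\<omega> (norm x) \<le> \<omega> R"
      using mono R x by (auto simp: mono_on_def)
    then have "1 \<le> exp (real n * \<omega> R) * exp (- (real n * \<omega> (norm x)))"
      by (simp add: mult_left_mono flip: exp_add)
    then have "?D * ?w * 1 \<le> ?D * ?w * (exp (real n * \<omega> R) * exp (- (real n * \<omega> (norm x))))"
      by (intro mult_left_mono) (auto simp: order_weight_nonneg)
    then have "ennreal (?D * ?w) \<le> ennreal (exp (real n * \<omega> R) * (?D * (exp (- (real n * \<omega> (norm x))) * ?w)))"
      by (intro ennreal_leI) (simp add: mult_ac)
    also have "\<dots> = ennreal (exp (real n * \<omega> R)) * (ennreal ?D * ereal_exp (- ereal (real n * \<omega> (norm x)) -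
          ereal (real m) * young_conj \<omega> (real (multi_order \<alpha>) / real m)))"
      unfolding scaled_conj_def[symmetric] ereal_exp_scaled_conj(1)[where \<omega>=\<omega>, OF \<omega>1]
      by (simp add: ennreal_mult order_weight_nonneg)
    also have "\<dots> \<le> ennreal (exp (real n * \<omega> R)) * O_norm \<omega> m n f"
      unfolding O_norm_def by (intro mult_left_mono SUP_upper2[of \<alpha>] SUP_upper2[of x]) auto
    finally show ?thesis
      unfolding scaled_conj_def[symmetric] ereal_exp_scaled_conj(2)[where \<omega>=\<omega>, OF \<omega>1]
      by (simp add: ennreal_mult order_weight_nonneg)
  qed
  then have "E_seminorm \<omega> K m f \<le> ennreal (exp (real n * \<omega> R)) * O_norm \<omega> m n f"
    unfolding E_seminorm_def by (intro SUP_least)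
  also have "\<dots> < \<infinity>"
    using f by (simp add: O_step_def ennreal_mult_less_top)
  finally show ?thesis .
qed

text \<open>Only the empty list gives a nonzero derivative, so the step \<open>n = 1\<close> works
  for every \<open>m\<close>. With \<open>c = 1\<close> this provides the test function that
  recovers a multiplier from its action.\<close>

lemma const_in_OM_space: "(\<lambda>x :: real^'n. c) \<in> OM_space \<omega>"
proof -
  have "O_norm \<omega> m 1 (\<lambda>x :: real^'n. c) \<le> ennreal (norm c * order_weight \<omega> m 0)" for m
  proof (subst O_norm_le_iff[where \<omega>=\<omega>, OF \<omega>1 smooth_const], intro mult_nonneg_nonneg norm_ge_zero order_weight_nonneg,
      intro allI)
    fix js and x :: "real^'n"
    have "exp (- real 1 * \<omega> (norm x)) * order_weight \<omega> m 0 \<le> 1 * order_weight \<omega> m 0"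
      using \<omega>_nonneg by (intro mult_right_mono order_weight_nonneg) auto
    then show "norm (iter_partial_deriv js (\<lambda>x. c) x) * (exp (- real 1 * \<omega> (norm x)) *
        order_weight \<omega> m (length js)) \<le> norm c * order_weight \<omega> m 0"
      by (auto simp: iter_partial_deriv_const order_weight_nonneg intro: mult_left_mono)
  qed
  then have "(\<lambda>x :: real^'n. c) \<in> O_step \<omega> m 1" for m
    unfolding O_step_def using smooth_const by (auto intro: le_less_trans[OF _ ennreal_less_top])
  then show ?thesis
    unfolding OM_space_def by (intro INT_I UN_I[of 1]) auto
qed

section \<open>Multiplication operators\<close>

lemma linear_on_functions_mult:
  "function_subspace X \<Longrightarrow> linear_on_functions X (\<lambda>g x. f x * g x)"
  by unfold_locales (auto simp: algebra_simps)

text \<open>Given the target level \<open>m\<close>, a source level m' \<ge> K m makes the product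
  estimate available. As \<open>f\<close> lies in one step \<open>k\<close> at level
  \<open>m'\<close>, multiplication sends step \<open>n\<close> at level \<open>m'\<close> boundedly
  into step \<open>k + n\<close> at level \<open>m\<close>, and the lemmas on limits do the
  rest.\<close>

lemma OM_space_mult_continuous:
  fixes f :: "real^'n \<Rightarrow> complex"
  assumes K: "K \<ge> 1" "\<And>t. t \<ge> 0 \<Longrightarrow> \<omega> (2 * t) \<le> K * (1 + \<omega> t)" and f: "f \<in> OM_space \<omega>"
  shows "continuous_map (OM_topology \<omega>) (OM_topology \<omega>) (\<lambda>g x. f x * g x)"
  unfolding OM_topology_def
proof (rule continuous_map_projective_limit)
  fix m :: nat assume "m \<in> {1..}"
  then have m: "m \<ge> 1" by simp
  define m' where "m' = nat \<lceil>K * real m\<rceil>"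
  have m'K: "K * real m \<le> real m'"
    by (simp add: m'_def real_nat_ceiling_ge)
  have "1 * 1 \<le> K * real m"
    using K(1) m by (intro mult_mono) auto
  then have m': "m' \<ge> 1"
    using m'K by linarith
  \<comment> \<open>This \<open>k\<close> is chosen once for the level \<open>m'\<close>, before the
    step \<open>n\<close> of the other factor is considered.\<close>
  obtain k where k: "f \<in> O_step \<omega> m' k" "k \<ge> 1"
    using f m' by (auto simp: OM_space_def)
  have "continuous_map (norm_topology (O_step \<omega> m' n) (O_norm \<omega> m' n))
      (norm_topology (O_step \<omega> m (k + n)) (O_norm \<omega> m (k + n))) (\<lambda>g x. f x * g x)" for n
  proof (rule continuous_map_norm_topology)
    define C where "C = ennreal (exp (real m')) * O_norm \<omega> m' k f"
    show C: "C < \<infinity>"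
      using k by (simp add: C_def O_step_def ennreal_mult_less_top)
    show le: "O_norm \<omega> m (k + n) (\<lambda>x. f x * g x) \<le> C * O_norm \<omega> m' n g" if "g \<in> O_step \<omega> m' n" for g
      unfolding C_def by (rule O_norm_mult_le[OF m m' K m'K \<omega>_nonneg \<omega>1 k(1) that])
    have "(\<lambda>x. f x * g x) \<in> O_step \<omega> m (k + n)" if g: "g \<in> O_step \<omega> m' n" for g
      using g k C le_less_trans[OF le[OF g]] by (auto simp: O_step_def ennreal_mult_less_top intro: smooth_mult)
    then show "(\<lambda>g x. f x * g x) ` O_step \<omega> m' n \<subseteq> O_step \<omega> m (k + n)"
      by blast
    show "O_norm \<omega> m (k + n) (\<lambda>x. g x + h x) \<le> O_norm \<omega> m (k + n) g + O_norm \<omega> m (k + n) h"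
      if "g \<in> O_step \<omega> m (k + n)" "h \<in> O_step \<omega> m (k + n)" for g h
      using that by (intro O_norm_triangle) (auto simp: O_step_def)
    show "linear_on_functions (O_step \<omega> m' n) (\<lambda>g x. f x * g x)"
      by (intro linear_on_functions_mult function_subspace_O_step)
    show "function_subspace (O_step \<omega> m (k + n) :: (real^'n \<Rightarrow> complex) set)"
      by (rule function_subspace_O_step)
  qed (auto simp: O_step_def O_norm_zero)
  then have cont: "\<exists>n'\<in>{1..}. continuous_map (norm_topology (O_step \<omega> m' n) (O_norm \<omega> m' n))
      (norm_topology (O_step \<omega> m n') (O_norm \<omega> m n')) (\<lambda>g x. f x * g x)" for n
    using k(2) by (intro bexI[of _ "k + n"]) auto
  have "continuous_map
      (lc_inductive_limit {1..} (\<lambda>n. norm_topology (O_step \<omega> m' n) (O_norm \<omega> m' n)))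
      (lc_inductive_limit {1..} (\<lambda>n. norm_topology (O_step \<omega> m n) (O_norm \<omega> m n))) (\<lambda>g x. f x * g x)"
  proof (rule continuous_map_lc_inductive_limit)
    show "linear_on_functions (\<Union>n\<in>{1..}. topspace (norm_topology (O_step \<omega> m' n) (O_norm \<omega> m' n)))
        (\<lambda>g x. f x * g x)"
      unfolding topspace_O_step_topology
      by (rule linear_on_functions_mult[OF function_subspace_Union_O_step])
    show "function_subspace
        (\<Union>n\<in>{1..}. topspace (norm_topology (O_step \<omega> m n :: (real^'n \<Rightarrow> complex) set) (O_norm \<omega> m n)))"
      unfolding topspace_O_step_topology by (rule function_subspace_Union_O_step)
  qed (rule cont)
  then show "\<exists>m'\<in>{1..}. continuous_map
      (lc_inductive_limit {1..} (\<lambda>n. norm_topology (O_step \<omega> m' n) (O_norm \<omega> m' n)))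
      (lc_inductive_limit {1..} (\<lambda>n. norm_topology (O_step \<omega> m n) (O_norm \<omega> m n))) (\<lambda>g x. f x * g x)"
    using m' by auto
qed

end

theorem mainTheorem5:
  fixes \<omega> :: "real \<Rightarrow> real"
  assumes "nonquasianalytic_weight \<omega>"
  shows "multipliers \<omega> (OM_topology \<omega> :: (real^'n \<Rightarrow> complex) topology) = OM_space \<omega>"
proof -
  have \<omega>1: "\<omega> 1 = 0" and nonneg: "\<And>t. t \<ge> 0 \<Longrightarrow> 0 \<le> \<omega> t" and mono: "mono_on {0..} \<omega>"
    using assms by (auto simp: nonquasianalytic_weight_def)
  obtain K where K: "K \<ge> 1" "\<And>t. t \<ge> 0 \<Longrightarrow> \<omega> (2 * t) \<le> K * (1 + \<omega> t)"
    using assms by (auto simp: nonquasianalytic_weight_def)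
  note top = topspace_OM_topology[where \<omega>=\<omega>, OF \<omega>1 nonneg]
  show ?thesis
  proof
    show "multipliers \<omega> (OM_topology \<omega> :: (real^'n \<Rightarrow> complex) topology) \<subseteq> OM_space \<omega>"
    proof
      fix f :: "real^'n \<Rightarrow> complex" assume "f \<in> multipliers \<omega> (OM_topology \<omega>)"
      then have "\<And>g. g \<in> OM_space \<omega> \<Longrightarrow> (\<lambda>x. f x * g x) \<in> OM_space \<omega>"
        by (simp add: multipliers_def top)
      from this[OF const_in_OM_space[where \<omega>=\<omega> and c=1, OF \<omega>1 nonneg]] show "f \<in> OM_space \<omega>"
        by simp
    qed
    show "OM_space \<omega> \<subseteq> multipliers \<omega> (OM_topology \<omega> :: (real^'n \<Rightarrow> complex) topology)"
    proof
      fix f :: "real^'n \<Rightarrow> complex" assume f: "f \<in> OM_space \<omega>"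
      then have step: "\<exists>n. f \<in> O_step \<omega> m n" if "m \<ge> 1" for m
        using that by (auto simp: OM_space_def)
      have "f \<in> E_space \<omega>"
        unfolding E_space_def
      proof (intro CollectI conjI allI impI)
        show "smooth f"
          using step[of 1] by (auto simp: O_step_def)
        show "E_seminorm \<omega> K m f < \<infinity>" if "1 \<le> m" "compact K" for K m
          using step[OF that(1)] E_seminorm_finite_if_O_step[where \<omega>=\<omega>, OF \<omega>1 nonneg mono _ that(2)]
          by blast
      qed
      moreover have cont: "continuous_map (OM_topology \<omega>) (OM_topology \<omega>) (\<lambda>g x. f x * g x)"
        by (rule OM_space_mult_continuous[where \<omega>=\<omega>, OF \<omega>1 nonneg K f])
      \<comment> \<open>Continuity between the topologies includes that the operator maps the
        underlying space into itself, which is the remaining condition on a multiplier.\<close>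
      ultimately show "f \<in> multipliers \<omega> (OM_topology \<omega>)"
        unfolding multipliers_def using continuous_map_image_subset_topspace[OF cont] by blast
    qed
  qed
qed

end
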